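(* Let $m,n,l\ge1$ be integers, let $b=2^l$ divide $n$, and define $\kappa_b=[2\sin(\pi/(2b))]^{-1}$. For every $G\in\mathbb{R}^{m\times n}$, with Haar detail coefficients $D^{(1)},\ldots,D^{(l)}$ and low-pass reconstruction $P_l(G)$, $$\sum_{j=1}^{l}\|D^{(j)}\|_F^2=\|G-P_l(G)\|_F^2\le\kappa_b^2\,\|\Delta G\|_F^2,$$ where $\Delta G\in\mathbb{R}^{m\times(n-1)}$ is given by $(\Delta G)_{:,k}=G_{:,k+1}-G_{:,k}$ for $k=1,\ldots,n-1$.
   Context: $\|\cdot\|_F$ is the Frobenius norm and $G_{:,k}$ is the $k$-th column of $G$. Haar transform. For even $s$, the Haar matrix $H_s\in\mathbb{R}^{s\times s}$ (which is orthogonal) has, for $i=1,\ldots,s/2$, entries $(H_s)_{2i-1,i}=(H_s)_{2i,i}=(H_s)_{2i-1,s/2+i}=\frac1{\sqrt2}$ and $(H_s)_{2i,s/2+i}=-\frac1{\sqrt2}$, all other entries being zero. For $G\in\mathbb{R}^{m\times n}$ with $2^l\mid n$, set $A^{(0)}=G$ and, for $j=1,\ldots,l$, define $A^{(j)},D^{(j)}\in\mathbb{R}^{m\times n/2^j}$ (approximation and detail coefficients) by $[A^{(j)},D^{(j)}]=A^{(j-1)}H_{n/2^{j-1}}$ (the first $n/2^j$ columns form $A^{(j)}$, the remaining ones $D^{(j)}$). The level-$l$ Haar transform is $\mathcal{H}_l(G)=(A^{(l)},D^{(l)},D^{(l-1)},\ldots,D^{(1)})$; it is a linear bijection with inverse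 $\mathcal{H}_l^{-1}$. $P_l(G)$ denotes the reconstruction obtained by retaining $A^{(l)}$ and setting all detail bands to zero: $P_l(G)=\mathcal{H}_l^{-1}(A^{(l)},0,\ldots,0)$. *)

theory Defs
  imports Complex_Main "Jordan_Normal_Form.Matrix"
begin

text \<open>Rows and columns of matrices are indexed from 0, so the entries with (1-based) indices
  \<open>(2i-1, i)\<close>, \<open>(2i, i)\<close>, \<open>(2i-1, s/2+i)\<close>, \<open>(2i, s/2+i)\<close> of the Haar matrix become
  \<open>(2i, i)\<close>, \<open>(2i+1, i)\<close>, \<open>(2i, s/2+i)\<close>, \<open>(2i+1, s/2+i)\<close> with \<open>i < s/2\<close>.\<close>

definition haar_matrix :: "nat \<Rightarrow> real mat" where
  "haar_matrix s = mat s s (\<lambda>(r, c).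
     if c < s div 2 then (if r = 2 * c \<or> r = 2 * c + 1 then 1 / sqrt 2 else 0)
     else (let i = c - s div 2 in
       if r = 2 * i then 1 / sqrt 2 else if r = 2 * i + 1 then - 1 / sqrt 2 else 0))"

definition frobenius_norm :: "real mat \<Rightarrow> real" where
  "frobenius_norm A = sqrt (\<Sum>i<dim_row A. \<Sum>k<dim_col A. (A $$ (i, k))\<^sup>2)"

primrec haar_approx :: "real mat \<Rightarrow> nat \<Rightarrow> real mat" where
  "haar_approx G 0 = G"
| "haar_approx G (Suc j) =
     (let B = haar_approx G j * haar_matrix (dim_col G div 2 ^ j)
      in mat (dim_row G) (dim_col G div 2 ^ Suc j) (\<lambda>(i, k). B $$ (i, k)))"

text \<open>Only meaningful for levels \<open>j \<ge> 1\<close>.\<close>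

definition haar_detail :: "real mat \<Rightarrow> nat \<Rightarrow> real mat" where
  "haar_detail G j =
     (let B = haar_approx G (j - 1) * haar_matrix (dim_col G div 2 ^ (j - 1));
          h = dim_col G div 2 ^ j
      in mat (dim_row G) h (\<lambda>(i, k). B $$ (i, h + k)))"

text \<open>The detail bands are listed from level \<open>l\<close> down to level 1.\<close>

definition haar_transform :: "nat \<Rightarrow> real mat \<Rightarrow> real mat \<times> real mat list" where
  "haar_transform l G = (haar_approx G l, map (haar_detail G) (rev [1..<Suc l]))"

text \<open>When \<open>2 ^ l\<close> divides \<open>n\<close>, the transform is injective on the \<open>m \<times> n\<close> matrices and every
  tuple of bands of the right dimensions is in its range, so that \<open>inv_into\<close> is the genuine
  inverse.\<close>

definition haar_inverse :: "nat \<Rightarrow> nat \<Rightarrow> nat \<Rightarrow> real mat \<times> real mat list \<Rightarrow> real mat" where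
  "haar_inverse m n l = inv_into (carrier_mat m n) (haar_transform l)"

definition haar_lowpass :: "nat \<Rightarrow> real mat \<Rightarrow> real mat" where
  "haar_lowpass l G =
     haar_inverse (dim_row G) (dim_col G) l
       (haar_approx G l, map (\<lambda>j. 0\<^sub>m (dim_row G) (dim_col G div 2 ^ j)) (rev [1..<Suc l]))"

definition column_diff :: "real mat \<Rightarrow> real mat" where
  "column_diff G =
     mat (dim_row G) (dim_col G - 1) (\<lambda>(i, k). G $$ (i, k + 1) - G $$ (i, k))"

definition haar_kappa :: "nat \<Rightarrow> real" where
  "haar_kappa b = inverse (2 * sin (pi / (2 * real b)))"

end

theory Submission
  imports Defs
begin

text \<open>The bands of the Haar transform are orthogonal, and keeping only the approximation band
  replaces each row of \<open>G\<close> on every block of \<open>b\<close> consecutive columns by its mean. The inequality is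
  therefore the sharp Poincare inequality for mean-zero vectors \<open>y\<close> on a path with \<open>b\<close> vertices.
  Its constant comes from the partial sums \<open>S\<close> of \<open>y\<close>, which vanish at both ends: comparison with
  the positive eigenfunction \<open>sin (\<pi> k / b)\<close> gives \<open>(2 sin (\<pi> / 2b))\<^sup>2 \<parallel>S\<parallel>\<^sup>2 \<le> \<parallel>y\<parallel>\<^sup>2\<close>, while summation by
  parts writes \<open>\<parallel>y\<parallel>\<^sup>2\<close> as the inner product of \<open>S\<close> and \<open>- \<Delta>y\<close>.\<close>

section \<open>Poincare inequality on a path\<close>

text \<open>The addition formulas at angle \<open>t\<close> and the half-angle form of
  \<open>cos t\<close>. In other words, \<open>sin (k t)\<close> is an eigenfunction of the negative
  second difference, with eigenvalue \<open>(2 * sin (t / 2))\<^sup>2\<close>.\<close>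

lemma sin_three_term:
  "sin (real k * t) + sin (real (Suc (Suc k)) * t) = (2 - (2 * sin (t / 2))\<^sup>2) * sin (real (Suc k) * t)"
proof -
  have "cos t = 1 - 2 * (sin (t / 2))\<^sup>2"
    using cos_double_sin[of "t / 2"] by simp
  moreover have "sin (real k * t) + sin (real (Suc (Suc k)) * t) = 2 * cos t * sin (real (Suc k) * t)"
    using sin_add[of "real (Suc k) * t" t] sin_diff[of "real (Suc k) * t" t]
    by (simp add: algebra_simps)
  ultimately show ?thesis
    by (simp only: power2_eq_square) (simp add: left_diff_distrib)
qed

text \<open>A discrete Picone argument: each edge energy is bounded below by one share for each of
  its endpoints, and the eigenvalue equation for the positive function \<open>p\<close> makes the
  two shares at a vertex add up to the eigenvalue times \<open>(S k)\<^sup>2\<close>.\<close>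

lemma discrete_dirichlet_inequality:
  fixes S :: "nat \<Rightarrow> real"
  assumes S0: "S 0 = 0" and Sb: "S b = 0"
  shows "(2 * sin (pi / (2 * real b)))\<^sup>2 * (\<Sum>k<b. (S k)\<^sup>2) \<le> (\<Sum>k<b. (S (Suc k) - S k)\<^sup>2)"
proof -
  define p where "p k = sin (real k * (pi / real b))" for k
  \<comment> \<open>\<open>g k\<close> is the share that vertex \<open>k\<close> receives from the
    edge on its left, \<open>h k\<close> the share from the edge on its right. At
    \<open>k = 0\<close> the truncated \<open>k - 1\<close> and the division by
    \<open>p 0 = 0\<close> are harmless because \<open>S 0 = 0\<close>.\<close>
  define g where "g k = (S k)\<^sup>2 * (1 - p (k - 1) / p k)" for k
  define h where "h k = (S k)\<^sup>2 * (1 - p (Suc k) / p k)" for k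
  have pos: "p k > 0" if "0 < k" "k < b" for k
    unfolding p_def using that by (intro sin_gt_zero) (auto simp: field_simps)
  have picone: "g (Suc k) + h k \<le> (S (Suc k) - S k)\<^sup>2" if "k < b" for k
  proof (cases "k = 0 \<or> Suc k = b")
    \<comment> \<open>On an end edge \<open>p\<close> vanishes at the boundary vertex, so no
      quotient of positive values is available; there \<open>S\<close> vanishes too and the bound is
      an equality.\<close>
    case True
    have "p 0 = 0" "p b = 0" using that by (auto simp: p_def)
    with True S0 Sb show ?thesis by (auto simp: g_def h_def)
  next
    case False
    then have P: "p k > 0" "p (Suc k) > 0" using that by (auto intro!: pos)
    \<comment> \<open>On an interior edge this quotient is exactly the defect in the inequality; it
      vanishes when \<open>S\<close> is proportional to \<open>p\<close> along the edge.\<close>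
    have "0 \<le> (S (Suc k) * p k - S k * p (Suc k))\<^sup>2 / (p k * p (Suc k))"
      using P by (intro divide_nonneg_pos) auto
    also have "\<dots> = (S (Suc k) - S k)\<^sup>2 - (g (Suc k) + h k)"
      using P by (simp add: g_def h_def field_simps power2_eq_square)
    finally show ?thesis by simp
  qed
  have gh: "g k + h k = (2 * sin (pi / (2 * real b)))\<^sup>2 * (S k)\<^sup>2" if "k < b" for k
  proof (cases k)
    case 0
    then show ?thesis using S0 by (simp add: g_def h_def)
  next
    case (Suc j)
    have "p j + p (Suc k) = (2 - (2 * sin (pi / (2 * real b)))\<^sup>2) * p k"
      using sin_three_term[of j "pi / real b"] unfolding p_def Suc by (simp add: mult.commute)
    moreover have "p k > 0" using pos that Suc by simp
    ultimately have "p j / p k + p (Suc k) / p k = 2 - (2 * sin (pi / (2 * real b)))\<^sup>2"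
      by (simp add: add_divide_distrib[symmetric])
    then have "(1 - p j / p k) + (1 - p (Suc k) / p k) = (2 * sin (pi / (2 * real b)))\<^sup>2"
      by linarith
    then show ?thesis
      unfolding g_def h_def Suc by (metis Suc diff_Suc_1 distrib_left mult.commute)
  qed
  \<comment> \<open>Passes from summing over edges to summing over vertices: the left shares are
    shifted by one index, and both boundary terms are zero.\<close>
  have "g 0 + (\<Sum>k<b. g (Suc k)) = (\<Sum>k<b. g k) + g b"
    by (simp flip: sum.lessThan_Suc add: sum.lessThan_Suc_shift del: sum.lessThan_Suc)
  moreover have "g 0 = 0" "g b = 0" using S0 Sb by (auto simp: g_def)
  ultimately have "(\<Sum>k<b. g (Suc k)) = (\<Sum>k<b. g k)" by simp
  then have "(\<Sum>k<b. g (Suc k) + h k) = (\<Sum>k<b. g k + h k)"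
    by (simp add: sum.distrib)
  also have "\<dots> = (2 * sin (pi / (2 * real b)))\<^sup>2 * (\<Sum>k<b. (S k)\<^sup>2)"
    unfolding sum_distrib_left by (rule sum.cong) (auto simp: gh)
  finally show ?thesis
    using sum_mono[of "{..<b}" "\<lambda>k. g (Suc k) + h k" "\<lambda>k. (S (Suc k) - S k)\<^sup>2"] picone by simp
qed

lemma summation_by_parts:
  fixes y S :: "nat \<Rightarrow> 'a :: comm_ring"
  shows "(\<Sum>k<Suc c. y k * (S (Suc k) - S k)) =
    y c * S (Suc c) - y 0 * S 0 - (\<Sum>k<c. S (Suc k) * (y (Suc k) - y k))"
  by (induction c) (auto simp: algebra_simps)

text \<open>Duality with the Dirichlet problem: the partial sums \<open>S\<close> have increments
  \<open>y\<close> and vanish at both ends precisely because \<open>y\<close> has sum zero, so the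
  previous inequality controls \<open>S\<close> by \<open>y\<close>.\<close>

lemma discrete_poincare_inequality:
  fixes y :: "nat \<Rightarrow> real"
  assumes "(\<Sum>k<b. y k) = 0"
  shows "(2 * sin (pi / (2 * real b)))\<^sup>2 * (\<Sum>k<b. (y k)\<^sup>2) \<le> (\<Sum>k<b - 1. (y (Suc k) - y k)\<^sup>2)"
proof (cases b)
  case 0
  then show ?thesis by simp
next
  case (Suc c)
  define S where "S k = (\<Sum>i<k. y i)" for k
  define L where "L = (2 * sin (pi / (2 * real b)))\<^sup>2"
  define Y where "Y = (\<Sum>k<b. (y k)\<^sup>2)"
  define D where "D = (\<Sum>k<c. (y (Suc k) - y k)\<^sup>2)"
  define T where "T = (\<Sum>k<b. (S k)\<^sup>2)"
  have S: "S 0 = 0" "S b = 0" using assms by (auto simp: S_def)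
  have y: "S (Suc k) - S k = y k" for k by (simp add: S_def)
  have LT: "L * T \<le> Y"
    using discrete_dirichlet_inequality[of S b] S by (simp add: y L_def T_def Y_def)
  have T: "(\<Sum>k<c. (S (Suc k))\<^sup>2) = T"
    unfolding T_def Suc by (simp add: sum.lessThan_Suc_shift S del: sum.lessThan_Suc)
  have Y: "(\<Sum>k<c. S (Suc k) * (y (Suc k) - y k)) = - Y"
    using summation_by_parts[of y S c] S unfolding y Suc Y_def by (simp add: power2_eq_square)
  \<comment> \<open>Replaces Cauchy-Schwarz. The weight \<open>L\<close> is chosen so that expanding
    gives \<open>2 * L * Y \<le> L\<^sup>2 * T + D\<close>, where \<open>L * T \<le> Y\<close>
    absorbs one copy of \<open>L * Y\<close>.\<close>
  have "0 \<le> (\<Sum>k<c. (L * S (Suc k) + (y (Suc k) - y k))\<^sup>2)"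
    by (intro sum_nonneg) auto
  also have "\<dots> = (\<Sum>k<c. L\<^sup>2 * (S (Suc k))\<^sup>2 + 2 * L * (S (Suc k) * (y (Suc k) - y k))
      + (y (Suc k) - y k)\<^sup>2)"
    by (intro sum.cong refl) (simp add: power2_eq_square algebra_simps)
  also have "\<dots> = L\<^sup>2 * T - 2 * L * Y + D"
    by (simp add: sum.distrib T Y D_def flip: sum_distrib_left)
  finally have "2 * (L * Y) \<le> L * (L * T) + D"
    by (simp add: power2_eq_square)
  moreover have "L * (L * T) \<le> L * Y"
    using LT by (intro mult_left_mono) (auto simp: L_def)
  ultimately have "L * Y \<le> D" by simp
  then show ?thesis by (simp add: L_def Y_def D_def Suc)
qed

text \<open>Subtracting the mean produces a mean-zero vector with the same differences. For
  \<open>b \<ge> 1\<close> the angle lies in the interval from 0 (excluded) to pi / 2, so the sine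
  is positive and can be moved to the other side as \<open>haar_kappa b\<close>.\<close>

lemma sum_sq_deviation_le:
  fixes x :: "nat \<Rightarrow> real"
  assumes "b \<ge> 1"
  shows "(\<Sum>k<b. (x k - (\<Sum>i<b. x i) / real b)\<^sup>2)
    \<le> (haar_kappa b)\<^sup>2 * (\<Sum>k<b - 1. (x (Suc k) - x k)\<^sup>2)"
proof -
  define y where "y k = x k - (\<Sum>i<b. x i) / real b" for k
  have "(\<Sum>k<b. y k) = 0" using assms by (simp add: y_def sum_subtractf)
  then have "(2 * sin (pi / (2 * real b)))\<^sup>2 * (\<Sum>k<b. (y k)\<^sup>2) \<le> (\<Sum>k<b - 1. (y (Suc k) - y k)\<^sup>2)"
    by (rule discrete_poincare_inequality)
  moreover have "sin (pi / (2 * real b)) > 0"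
    using assms by (intro sin_gt_zero) (auto simp: field_simps)
  ultimately have "(\<Sum>k<b. (y k)\<^sup>2) \<le> (haar_kappa b)\<^sup>2 * (\<Sum>k<b - 1. (y (Suc k) - y k)\<^sup>2)"
    by (simp add: haar_kappa_def field_simps)
  then show ?thesis by (simp add: y_def)
qed

section \<open>Haar bands\<close>

lemma frobenius_norm_sq:
  "(frobenius_norm A)\<^sup>2 = (\<Sum>i<dim_row A. \<Sum>k<dim_col A. (A $$ (i, k))\<^sup>2)"
  unfolding frobenius_norm_def by (intro real_sqrt_pow2 sum_nonneg) auto

lemma frobenius_norm_eq_0_iff:
  "frobenius_norm A = 0 \<longleftrightarrow> (\<forall>i<dim_row A. \<forall>k<dim_col A. A $$ (i, k) = 0)"
  unfolding frobenius_norm_def by (auto simp: sum_nonneg_eq_0_iff sum_nonneg)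

lemma dim_haar_approx [simp]:
  "dim_row (haar_approx G j) = dim_row G" "dim_col (haar_approx G j) = dim_col G div 2 ^ j"
  by (cases j; simp add: Let_def)+

lemma dim_haar_detail [simp]:
  "dim_row (haar_detail G j) = dim_row G" "dim_col (haar_detail G j) = dim_col G div 2 ^ j"
  by (simp_all add: haar_detail_def Let_def)

text \<open>Every column of a Haar matrix has just two nonzero entries; this evaluates the product
  of a row with such a column.\<close>

lemma sum_two_entries:
  fixes a :: "nat \<Rightarrow> real"
  assumes "q < s" "p < s" "p \<noteq> q"
  shows "(\<Sum>r = 0..<s. a r * (if r = p then u else if r = q then v else 0)) = a p * u + a q * v"
proof -
  have "(\<Sum>r = 0..<s. a r * (if r = p then u else if r = q then v else 0)) =
    (\<Sum>r = 0..<s. (if r = p then a r * u else 0) + (if r = q then a r * v else 0))"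
    using assms by (intro sum.cong) auto
  also have "\<dots> = a p * u + a q * v" using assms by (simp add: sum.distrib)
  finally show ?thesis .
qed

lemma mult_haar_matrix:
  assumes "dim_col A = s" "i < dim_row A" "even s" "k < s div 2"
  shows "(A * haar_matrix s) $$ (i, k) = (A $$ (i, 2 * k) + A $$ (i, 2 * k + 1)) / sqrt 2"
    and "(A * haar_matrix s) $$ (i, s div 2 + k) = (A $$ (i, 2 * k) - A $$ (i, 2 * k + 1)) / sqrt 2"
proof -
  have k: "2 * k < s" "2 * k + 1 < s" using assms(3,4) by auto
  \<comment> \<open>The disjunction in the Haar matrix is split into two branches of equal value to
    match \<open>sum_two_entries\<close>.\<close>
  have "(A * haar_matrix s) $$ (i, k) = (\<Sum>r = 0..<s. A $$ (i, r) *
      (if r = 2 * k then 1 / sqrt 2 else if r = 2 * k + 1 then 1 / sqrt 2 else 0))"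
    using assms by (auto simp: haar_matrix_def scalar_prod_def intro!: sum.cong)
  then show "(A * haar_matrix s) $$ (i, k) = (A $$ (i, 2 * k) + A $$ (i, 2 * k + 1)) / sqrt 2"
    using k by (simp add: sum_two_entries add_divide_distrib)
  have "(A * haar_matrix s) $$ (i, s div 2 + k) = (\<Sum>r = 0..<s. A $$ (i, r) *
      (if r = 2 * k then 1 / sqrt 2 else if r = 2 * k + 1 then - 1 / sqrt 2 else 0))"
    using assms by (auto simp: haar_matrix_def scalar_prod_def Let_def intro!: sum.cong)
  then show "(A * haar_matrix s) $$ (i, s div 2 + k) = (A $$ (i, 2 * k) - A $$ (i, 2 * k + 1)) / sqrt 2"
    using k by (simp add: sum_two_entries diff_divide_distrib)
qed

lemma haar_step:
  assumes dvd: "2 ^ Suc j dvd dim_col G" and i: "i < dim_row G" and k: "k < dim_col G div 2 ^ Suc j"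
  shows "haar_approx G (Suc j) $$ (i, k) =
      (haar_approx G j $$ (i, 2 * k) + haar_approx G j $$ (i, 2 * k + 1)) / sqrt 2"
    and "haar_detail G (Suc j) $$ (i, k) =
      (haar_approx G j $$ (i, 2 * k) - haar_approx G j $$ (i, 2 * k + 1)) / sqrt 2"
proof -
  let ?s = "dim_col G div 2 ^ j"
  obtain q where q: "dim_col G = 2 ^ Suc j * q" using dvd by (elim dvdE)
  have s: "even ?s" "dim_col G div 2 ^ Suc j = ?s div 2"
    unfolding q by (auto simp: mult.assoc mult.left_commute)
  note haar = mult_haar_matrix[of "haar_approx G j" ?s i k]
  show "haar_approx G (Suc j) $$ (i, k) =
      (haar_approx G j $$ (i, 2 * k) + haar_approx G j $$ (i, 2 * k + 1)) / sqrt 2"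
    using haar(1) s i k by (simp add: Let_def)
  show "haar_detail G (Suc j) $$ (i, k) =
      (haar_approx G j $$ (i, 2 * k) - haar_approx G j $$ (i, 2 * k + 1)) / sqrt 2"
    using haar(2) s i k unfolding haar_detail_def by (simp add: Let_def)
qed

text \<open>Each level merges two adjacent blocks and contributes one factor
  \<open>1 / sqrt 2\<close>, so induction gives a scaled block sum. Linearity and the link with
  block means are read off from this closed form.\<close>

lemma haar_approx_entry:
  assumes "2 ^ j dvd dim_col G" "i < dim_row G" "k < dim_col G div 2 ^ j"
  shows "haar_approx G j $$ (i, k) = (\<Sum>r<2 ^ j. G $$ (i, k * 2 ^ j + r)) / sqrt 2 ^ j"
  using assms
proof (induction j arbitrary: k)
  case 0
  then show ?case by simp
next
  case (Suc j)
  obtain q where q: "dim_col G = 2 ^ Suc j * q" using Suc.prems(1) by (elim dvdE)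
  have k: "k < q" using Suc.prems(3) unfolding q by simp
  have "dim_col G div 2 ^ j = 2 * q" unfolding q by (simp add: mult.assoc mult.left_commute)
  moreover have "2 ^ j dvd dim_col G" unfolding q by simp
  ultimately have IH: "haar_approx G j $$ (i, k') = (\<Sum>r<2 ^ j. G $$ (i, k' * 2 ^ j + r)) / sqrt 2 ^ j"
    if "k' < 2 * q" for k'
    using Suc.IH[of k'] Suc.prems(2) that by simp
  have "(\<Sum>r<2 ^ Suc j. G $$ (i, k * 2 ^ Suc j + r)) =
     (\<Sum>r<2 ^ j. G $$ (i, 2 * k * 2 ^ j + r)) + (\<Sum>r<2 ^ j. G $$ (i, (2 * k + 1) * 2 ^ j + r))"
  proof -
    have "(\<Sum>r<2 ^ j + 2 ^ j. f r) = (\<Sum>r<2 ^ j. f r) + (\<Sum>r<2 ^ j. f (2 ^ j + r))"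
      for f :: "nat \<Rightarrow> real"
      using sum.nat_group[of f "2 ^ j" 2] sum.shift_bounds_nat_ivl[of f 0 "2 ^ j" "2 ^ j"]
      by (simp add: numeral_2_eq_2 lessThan_atLeast0 add.commute)
    from this[of "\<lambda>r. G $$ (i, k * 2 ^ Suc j + r)"] show ?thesis
      by (simp add: algebra_simps mult_2)
  qed
  then show ?case
    using haar_step(1)[OF Suc.prems] IH[of "2 * k"] IH[of "2 * k + 1"] k
    by (simp add: add_divide_distrib mult.commute[of "sqrt 2"] del: haar_approx.simps)
qed

lemma block_index_less:
  fixes q r b n :: nat
  assumes "b dvd n" "q < n div b" "r < b"
  shows "q * b + r < n"
proof -
  have "q * b + r < Suc q * b" using assms(3) by simp
  also have "\<dots> \<le> n"
    using assms(1,2) by (metis Suc_leI dvd_div_mult_self mult_le_mono1)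
  finally show ?thesis .
qed

lemma haar_approx_minus:
  assumes "dim_row B = dim_row A" "dim_col B = dim_col A" "2 ^ j dvd dim_col A"
    and "i < dim_row A" "k < dim_col A div 2 ^ j"
  shows "haar_approx (A - B) j $$ (i, k) = haar_approx A j $$ (i, k) - haar_approx B j $$ (i, k)"
proof -
  have "k * 2 ^ j + r < dim_col A" if "r < 2 ^ j" for r
    using assms(3,5) that by (rule block_index_less)
  then have "(\<Sum>r<2 ^ j. (A - B) $$ (i, k * 2 ^ j + r)) =
      (\<Sum>r<2 ^ j. A $$ (i, k * 2 ^ j + r)) - (\<Sum>r<2 ^ j. B $$ (i, k * 2 ^ j + r))"
    using assms by (simp add: sum_subtractf[symmetric])
  then show ?thesis
    using assms by (simp add: haar_approx_entry diff_divide_distrib)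
qed

lemma haar_detail_minus:
  assumes "dim_row B = dim_row A" "dim_col B = dim_col A" "2 ^ Suc j dvd dim_col A"
    and "i < dim_row A" "k < dim_col A div 2 ^ Suc j"
  shows "haar_detail (A - B) (Suc j) $$ (i, k) =
    haar_detail A (Suc j) $$ (i, k) - haar_detail B (Suc j) $$ (i, k)"
proof -
  obtain q where q: "dim_col A = 2 ^ Suc j * q" using assms(3) by (elim dvdE)
  have h: "dim_col A div 2 ^ j = 2 * q" "dim_col A div 2 ^ Suc j = q"
    unfolding q by (auto simp: mult.assoc mult.left_commute)
  have "2 ^ j dvd dim_col A" unfolding q by simp
  then have "haar_approx (A - B) j $$ (i, k') = haar_approx A j $$ (i, k') - haar_approx B j $$ (i, k')"
    if "k' < 2 * q" for k'
    using that assms h by (intro haar_approx_minus) auto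
  then show ?thesis
    using assms h by (simp add: haar_step diff_divide_distrib add_divide_distrib)
qed

section \<open>Energy identity and injectivity of the Haar transform\<close>

lemma sum_even_odd:
  fixes f :: "nat \<Rightarrow> 'a :: comm_monoid_add"
  shows "(\<Sum>k<2 * h. f k) = (\<Sum>k<h. f (2 * k) + f (2 * k + 1))"
  by (induction h) (auto simp: add.assoc)

text \<open>Orthogonality of the Haar matrix in coordinates: on each pair of adjacent columns it
  acts as the plane isometry sending \<open>(u, v)\<close> to
  \<open>((u + v) / sqrt 2, (u - v) / sqrt 2)\<close>.\<close>

lemma haar_step_energy:
  assumes "2 ^ Suc j dvd dim_col G"
  shows "(frobenius_norm (haar_approx G j))\<^sup>2 =
    (frobenius_norm (haar_approx G (Suc j)))\<^sup>2 + (frobenius_norm (haar_detail G (Suc j)))\<^sup>2"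
proof -
  obtain q where q: "dim_col G = 2 ^ Suc j * q" using assms by (elim dvdE)
  have h: "dim_col G div 2 ^ j = 2 * q" "dim_col G div 2 ^ Suc j = q"
    unfolding q by (auto simp: mult.assoc mult.left_commute)
  have rotation: "u\<^sup>2 + v\<^sup>2 = ((u + v) / sqrt 2)\<^sup>2 + ((u - v) / sqrt 2)\<^sup>2" for u v :: real
    by (simp add: power_divide power2_sum power2_diff field_simps)
  show ?thesis
    unfolding frobenius_norm_sq dim_haar_approx dim_haar_detail h sum_even_odd
      sum.distrib[symmetric]
    using assms h by (intro sum.cong refl, subst rotation)
      (simp add: haar_step del: haar_approx.simps)
qed

lemma haar_energy:
  assumes "2 ^ l dvd dim_col G"
  shows "(frobenius_norm G)\<^sup>2 =
    (frobenius_norm (haar_approx G l))\<^sup>2 + (\<Sum>j = 1..l. (frobenius_norm (haar_detail G j))\<^sup>2)"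
  using assms
proof (induction l)
  case (Suc l)
  then have "2 ^ l dvd dim_col G" by (metis dvd_mult_right power_Suc)
  with Suc haar_step_energy[of l G] show ?case by (simp del: haar_approx.simps(2))
qed simp

lemma haar_transform_eq_iff:
  "haar_transform l A = haar_transform l B \<longleftrightarrow>
    haar_approx A l = haar_approx B l \<and> (\<forall>j\<in>{1..l}. haar_detail A j = haar_detail B j)"
  by (auto simp: haar_transform_def)

text \<open>If all bands of \<open>A\<close> and \<open>B\<close> agree, linearity makes every band
  of \<open>A - B\<close> zero, and the energy identity forces \<open>A - B\<close> to vanish.
  Injectivity is what lets \<open>inv_into\<close> recover a matrix from its bands.\<close>

lemma inj_on_haar_transform:
  assumes "2 ^ l dvd n"
  shows "inj_on (haar_transform l) (carrier_mat m n)"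
proof (rule inj_onI)
  fix A B :: "real mat"
  assume AB: "A \<in> carrier_mat m n" "B \<in> carrier_mat m n"
    and eq: "haar_transform l A = haar_transform l B"
  have bands: "haar_approx A l = haar_approx B l"
    "\<And>j. j \<in> {1..l} \<Longrightarrow> haar_detail A j = haar_detail B j"
    using eq by (auto simp: haar_transform_eq_iff)
  have "frobenius_norm (haar_approx (A - B) l) = 0"
    using AB assms bands(1) by (auto simp: frobenius_norm_eq_0_iff haar_approx_minus)
  moreover have "frobenius_norm (haar_detail (A - B) j) = 0" if j: "j \<in> {1..l}" for j
  proof -
    obtain j' where j': "j = Suc j'" using j by (cases j) auto
    have "2 ^ j dvd n" using assms j by (meson atLeastAtMost_iff dvd_trans le_imp_power_dvd)
    with AB bands(2)[OF j] show ?thesis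
      unfolding j' by (auto simp: frobenius_norm_eq_0_iff haar_detail_minus simp del: power_Suc)
  qed
  ultimately have "(frobenius_norm (A - B))\<^sup>2 = 0"
    using haar_energy[of l "A - B"] AB assms by simp
  then show "A = B"
    using AB by (intro eq_matI) (auto simp: frobenius_norm_eq_0_iff)
qed

section \<open>Low-pass reconstruction as block means\<close>

text \<open>Explicit candidate for the low-pass reconstruction; \<open>k div b * b\<close> is the
  first column of the block containing column \<open>k\<close>.\<close>

definition block_mean :: "nat \<Rightarrow> real mat \<Rightarrow> real mat" where
  "block_mean b G = mat (dim_row G) (dim_col G)
     (\<lambda>(i, k). (\<Sum>r<b. G $$ (i, k div b * b + r)) / real b)"

lemma dim_block_mean [simp]:
  "dim_row (block_mean b G) = dim_row G" "dim_col (block_mean b G) = dim_col G"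
  by (simp_all add: block_mean_def)

lemma block_mean_entry:
  assumes "b dvd dim_col G" "i < dim_row G" "q < dim_col G div b" "r < b"
  shows "block_mean b G $$ (i, q * b + r) = (\<Sum>s<b. G $$ (i, q * b + s)) / real b"
  using assms block_index_less[of b "dim_col G" q r] by (simp add: block_mean_def)

lemma haar_approx_block_mean:
  assumes "2 ^ l dvd dim_col G"
  shows "haar_approx (block_mean (2 ^ l) G) l = haar_approx G l"
proof (rule eq_matI)
  fix i k assume "i < dim_row (haar_approx G l)" "k < dim_col (haar_approx G l)"
  then show "haar_approx (block_mean (2 ^ l) G) l $$ (i, k) = haar_approx G l $$ (i, k)"
    using assms block_mean_entry[of "2 ^ l" G i k] by (simp add: haar_approx_entry)
qed auto

text \<open>A detail coefficient of level \<open>j \<le> l\<close> compares the two halves of a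
  block of length \<open>2 ^ j\<close>. Both halves lie in one block of length \<open>2 ^ l\<close>,
  on which the block mean is constant.\<close>

lemma haar_detail_block_mean:
  assumes "2 ^ l dvd dim_col G" "j \<in> {1..l}"
  shows "haar_detail (block_mean (2 ^ l) G) j = 0\<^sub>m (dim_row G) (dim_col G div 2 ^ j)"
proof (rule eq_matI)
  fix i k assume "i < dim_row (0\<^sub>m (dim_row G) (dim_col G div 2 ^ j) :: real mat)"
    "k < dim_col (0\<^sub>m (dim_row G) (dim_col G div 2 ^ j) :: real mat)"
  then have i: "i < dim_row G" and k: "k < dim_col G div 2 ^ j" by auto
  obtain j' where j': "j = Suc j'" using assms(2) by (cases j) auto
  have jl: "2 ^ j dvd dim_col G" using assms by (meson atLeastAtMost_iff dvd_trans le_imp_power_dvd)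
  obtain q where q: "dim_col G = 2 ^ j * q" using jl by (elim dvdE)
  have h: "dim_col G div 2 ^ j' = 2 * q" "k < q" "2 ^ j' dvd dim_col G"
    using k unfolding q j' by (auto simp: mult.assoc mult.left_commute)
  have pl: "(2 ^ l :: nat) = 2 ^ j * 2 ^ (l - j)"
    using assms(2) by (simp flip: power_add)
  have same: "block_mean (2 ^ l) G $$ (i, 2 * k * 2 ^ j' + r) =
      block_mean (2 ^ l) G $$ (i, (2 * k + 1) * 2 ^ j' + r)" if r: "r < 2 ^ j'" for r
  proof -
    \<comment> \<open>Both columns lie in the \<open>k\<close>-th block of length
      \<open>2 ^ j\<close>; dividing further by \<open>2 ^ (l - j)\<close> puts them in the same
      block of length \<open>2 ^ l\<close>.\<close>
    have "(2 * k * 2 ^ j' + r) div 2 ^ j = k" "((2 * k + 1) * 2 ^ j' + r) div 2 ^ j = k"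
      using r unfolding j' by (auto intro!: div_nat_eqI simp: algebra_simps)
    then have "(2 * k * 2 ^ j' + r) div 2 ^ l = ((2 * k + 1) * 2 ^ j' + r) div 2 ^ l"
      by (simp add: pl div_mult2_eq)
    moreover have "2 * k * 2 ^ j' + r < dim_col G" "(2 * k + 1) * 2 ^ j' + r < dim_col G"
      using h r block_index_less[of "2 ^ j'" "dim_col G" "2 * k" r]
        block_index_less[of "2 ^ j'" "dim_col G" "2 * k + 1" r] by auto
    ultimately show ?thesis using i by (simp add: block_mean_def)
  qed
  have "haar_approx (block_mean (2 ^ l) G) j' $$ (i, 2 * k) =
      haar_approx (block_mean (2 ^ l) G) j' $$ (i, 2 * k + 1)"
    using h i same by (simp add: haar_approx_entry)
  then have "haar_detail (block_mean (2 ^ l) G) j $$ (i, k) = 0"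
    using haar_step(2)[of j' "block_mean (2 ^ l) G" i k] jl i k unfolding j' by simp
  then show "haar_detail (block_mean (2 ^ l) G) j $$ (i, k) =
      0\<^sub>m (dim_row G) (dim_col G div 2 ^ j) $$ (i, k)"
    using i k by simp
qed auto

text \<open>The block mean has exactly the prescribed bands, hence by injectivity it is the preimage
  chosen by \<open>inv_into\<close>.\<close>

lemma haar_lowpass_eq_block_mean:
  assumes "2 ^ l dvd dim_col G"
  shows "haar_lowpass l G = block_mean (2 ^ l) G"
proof -
  let ?P = "block_mean (2 ^ l) G"
  have "(haar_approx G l, map (\<lambda>j. 0\<^sub>m (dim_row G) (dim_col G div 2 ^ j)) (rev [1..<Suc l]))
      = haar_transform l ?P"
    using haar_detail_block_mean[OF assms] haar_approx_block_mean[OF assms]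
    by (auto simp: haar_transform_def)
  moreover have "?P \<in> carrier_mat (dim_row G) (dim_col G)"
    by (rule carrier_matI) simp_all
  ultimately show ?thesis
    unfolding haar_lowpass_def haar_inverse_def
    using inj_on_haar_transform[OF assms] by (simp only: inv_into_f_f)
qed

text \<open>The energy identity applied to the residual: its approximation band cancels, while its
  detail bands are those of \<open>G\<close>.\<close>

lemma frobenius_norm_sub_block_mean:
  assumes dvd: "2 ^ l dvd dim_col G"
  shows "(frobenius_norm (G - block_mean (2 ^ l) G))\<^sup>2 =
    (\<Sum>j = 1..l. (frobenius_norm (haar_detail G j))\<^sup>2)"
proof -
  let ?R = "G - block_mean (2 ^ l) G"
  have "frobenius_norm (haar_approx ?R l) = 0"
    using dvd by (auto simp: frobenius_norm_eq_0_iff haar_approx_minus haar_approx_block_mean)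
  moreover have "frobenius_norm (haar_detail ?R j) = frobenius_norm (haar_detail G j)"
    if j: "j \<in> {1..l}" for j
  proof -
    obtain j' where j': "j = Suc j'" using j by (cases j) auto
    have "2 ^ j dvd dim_col G" using dvd j by (meson atLeastAtMost_iff dvd_trans le_imp_power_dvd)
    then have "haar_detail ?R j = haar_detail G j"
      using haar_detail_block_mean[OF dvd j] unfolding j'
      by (intro eq_matI) (auto simp: haar_detail_minus simp del: power_Suc)
    then show ?thesis by simp
  qed
  ultimately show ?thesis
    using haar_energy[of l ?R] dvd by simp
qed

section \<open>Summing the path inequality over blocks and rows\<close>

lemma sum_blocks:
  fixes f :: "nat \<Rightarrow> 'a :: comm_monoid_add"
  assumes "b dvd n"
  shows "(\<Sum>k<n. f k) = (\<Sum>q<n div b. \<Sum>r<b. f (q * b + r))"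
proof -
  have "(\<Sum>k<n. f k) = (\<Sum>q<n div b. sum f {q * b..<q * b + b})"
    using assms by (simp add: sum.nat_group)
  also have "\<dots> = (\<Sum>q<n div b. \<Sum>r<b. f (q * b + r))"
  proof (rule sum.cong[OF refl])
    fix q
    show "sum f {q * b..<q * b + b} = (\<Sum>r<b. f (q * b + r))"
      using sum.shift_bounds_nat_ivl[of f 0 "q * b" b] by (simp add: lessThan_atLeast0 add.commute)
  qed
  finally show ?thesis .
qed

text \<open>The terms present only on the right belong to differences across a boundary between
  consecutive blocks; they are nonnegative, so discarding them is allowed.\<close>

lemma sum_within_blocks_le:
  fixes f :: "nat \<Rightarrow> real"
  assumes "b dvd n" "b \<ge> 1" "\<And>k. f k \<ge> 0"
  shows "(\<Sum>q<n div b. \<Sum>r<b - 1. f (q * b + r)) \<le> (\<Sum>k<n - 1. f k)"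
proof -
  \<comment> \<open>There are only \<open>n - 1\<close> differences, a number that need not be a
    multiple of \<open>b\<close>; padding by zero to length \<open>n\<close> makes the block
    decomposition applicable.\<close>
  define g where "g k = (if k < n - 1 then f k else 0)" for k
  have "f (q * b + r) = g (q * b + r)" if "q < n div b" "r < b - 1" for q r
  proof -
    have "q * b + Suc r < n" using assms(1) that by (intro block_index_less) auto
    then show ?thesis by (simp add: g_def)
  qed
  then have "(\<Sum>q<n div b. \<Sum>r<b - 1. f (q * b + r)) = (\<Sum>q<n div b. \<Sum>r<b - 1. g (q * b + r))"
    by simp
  also have "\<dots> \<le> (\<Sum>q<n div b. \<Sum>r<b. g (q * b + r))"
    using assms(3) by (intro sum_mono sum_mono2) (auto simp: g_def)
  also have "\<dots> = (\<Sum>k<n. g k)" using sum_blocks[OF assms(1)] by metis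
  also have "\<dots> = (\<Sum>k<n - 1. f k)"
    by (rule sum.mono_neutral_cong_right) (auto simp: g_def)
  finally show ?thesis .
qed

text \<open>In each row, every block is a path with \<open>b\<close> vertices to which
  \<open>sum_sq_deviation_le\<close> applies with the same constant; summing over blocks and then
  rows gives the bound.\<close>

lemma frobenius_norm_sub_block_mean_le:
  assumes dvd: "b dvd dim_col G" and b: "b \<ge> 1"
  shows "(frobenius_norm (G - block_mean b G))\<^sup>2 \<le> (haar_kappa b)\<^sup>2 * (frobenius_norm (column_diff G))\<^sup>2"
proof -
  let ?n = "dim_col G"
  let ?d = "\<lambda>i k. (G $$ (i, Suc k) - G $$ (i, k))\<^sup>2"
  have row: "(\<Sum>k<?n. ((G - block_mean b G) $$ (i, k))\<^sup>2) \<le> (haar_kappa b)\<^sup>2 * (\<Sum>k<?n - 1. ?d i k)"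
    if i: "i < dim_row G" for i
  proof -
    have "(\<Sum>k<?n. ((G - block_mean b G) $$ (i, k))\<^sup>2) =
        (\<Sum>q<?n div b. \<Sum>r<b. ((G - block_mean b G) $$ (i, q * b + r))\<^sup>2)"
      by (rule sum_blocks[OF dvd])
    also have "\<dots> = (\<Sum>q<?n div b. \<Sum>r<b.
        (G $$ (i, q * b + r) - (\<Sum>s<b. G $$ (i, q * b + s)) / real b)\<^sup>2)"
      using dvd i by (intro sum.cong refl) (simp add: block_mean_entry block_index_less)
    also have "\<dots> \<le> (\<Sum>q<?n div b. (haar_kappa b)\<^sup>2 * (\<Sum>r<b - 1. ?d i (q * b + r)))"
    proof (rule sum_mono)
      fix q
      show "(\<Sum>r<b. (G $$ (i, q * b + r) - (\<Sum>s<b. G $$ (i, q * b + s)) / real b)\<^sup>2)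
          \<le> (haar_kappa b)\<^sup>2 * (\<Sum>r<b - 1. ?d i (q * b + r))"
        using sum_sq_deviation_le[OF b, of "\<lambda>r. G $$ (i, q * b + r)"] by simp
    qed
    also have "\<dots> = (haar_kappa b)\<^sup>2 * (\<Sum>q<?n div b. \<Sum>r<b - 1. ?d i (q * b + r))"
      by (simp add: sum_distrib_left)
    also have "\<dots> \<le> (haar_kappa b)\<^sup>2 * (\<Sum>k<?n - 1. ?d i k)"
      using sum_within_blocks_le[OF dvd b, of "?d i"] by (intro mult_left_mono) auto
    finally show ?thesis .
  qed
  have "(frobenius_norm (column_diff G))\<^sup>2 = (\<Sum>i<dim_row G. \<Sum>k<?n - 1. ?d i k)"
    by (simp add: frobenius_norm_sq column_diff_def)
  moreover have "(frobenius_norm (G - block_mean b G))\<^sup>2 \<le>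
      (\<Sum>i<dim_row G. (haar_kappa b)\<^sup>2 * (\<Sum>k<?n - 1. ?d i k))"
    unfolding frobenius_norm_sq using row by (auto intro!: sum_mono)
  ultimately show ?thesis by (simp add: sum_distrib_left)
qed

theorem lemma3p1:
  fixes m n l b :: nat and G :: "real mat"
  assumes "m \<ge> 1" and "n \<ge> 1" and "l \<ge> 1"
    and "b = 2 ^ l" and "b dvd n"
    and "G \<in> carrier_mat m n"
  shows "(\<Sum>j = 1..l. (frobenius_norm (haar_detail G j))\<^sup>2) = (frobenius_norm (G - haar_lowpass l G))\<^sup>2
    \<and> (frobenius_norm (G - haar_lowpass l G))\<^sup>2 \<le> (haar_kappa b)\<^sup>2 * (frobenius_norm (column_diff G))\<^sup>2"
proof -
  have "2 ^ l dvd dim_col G" using assms by auto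
  then show ?thesis
    using frobenius_norm_sub_block_mean[of l G] frobenius_norm_sub_block_mean_le[of b G] assms(4)
    by (simp add: haar_lowpass_eq_block_mean)
qed

end
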